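(* Let $f(x\mid\theta)=\exp[\alpha(\theta)\gamma(x)-\beta(\theta)+\delta(x)]$, $\theta\in\Theta\subseteq\mathbb{R}$, be a one-parameter exponential family and let $\theta_0\in\Theta$. Suppose that the function $$\theta_1\mapsto \frac{\beta(\theta_1)-\beta(\theta_0)}{\alpha(\theta_1)-\alpha(\theta_0)}$$ is (well defined and) strictly increasing on $\Theta\setminus\{\theta_0\}$. Let $x_1,\dots,x_T$ be data and let $0\le\tau_i<\tau_j<T$ be integers for which the roots $\theta_1^{\tau_i}$ and $\theta_1^{\tau_j}$ exist. Then the sign of $\bar\gamma_{\tau_i:\tau_j}-\bar\gamma_{\tau_j:T}$ (positive, zero or negative) is the same as the sign of $\theta_1^{\tau_i}-\theta_1^{\tau_j}$.
   Context: Here $\alpha,\beta:\Theta\to\mathbb{R}$ and $\gamma,\delta$ are real-valued functions of a data point. For integers $0\le s<u\le T$, $$\bar\gamma_{s:u}=\frac{1}{u-s}\sum_{t=s+1}^{u}\gamma(x_t).$$ For data $x_{1:T}=(x_1,\dots,x_T)$ the log-likelihood with pre-change parameter $\theta_0$, post-change parameter $\theta_1$ and change at $\tau$ is $$\ell(x_{1:T}\vert\theta_0,\theta_1,\tau)=\sum_{t=1}^{\tau}\log f(x_t\mid\theta_0)+\sum_{t=\tau+1}^{T}\log f(x_t\mid\theta_1),$$ and $\ell(x_{1:T}\vert\theta_0,\cdot,T)=\sum_{t=1}^{T}\log f(x_t\mid\theta_0)$. For $\tau<T$, $\theta_1^{\tau}$ denotes the root different from $\theta_0$, i.e. the element $\theta_1^\tau\in\Theta\setminus\{\theta_0\}$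 with $$\ell(x_{1:T}\vert\theta_0,\theta_1^{\tau},\tau)-\ell(x_{1:T}\vert\theta_0,\cdot,T)=0 .$$ *)

theory Defs
  imports "HOL-Probability.Probability"
begin

(* The densities are taken with respect to an arbitrary dominating measure M, so that continuous
   (M = lborel) and discrete (M = count_space S) families are both covered.  The common support of
   the family is space M. *)
definition exponential_family ::
  "'a measure \<Rightarrow> real set \<Rightarrow> (real \<Rightarrow> real) \<Rightarrow> (real \<Rightarrow> real) \<Rightarrow> ('a \<Rightarrow> real) \<Rightarrow> ('a \<Rightarrow> real)
    \<Rightarrow> ('a \<Rightarrow> real \<Rightarrow> real) \<Rightarrow> bool" where
  "exponential_family M \<Theta> \<alpha> \<beta> \<gamma> \<delta> f \<longleftrightarrow>
     \<gamma> \<in> borel_measurable M \<and> \<delta> \<in> borel_measurable M \<and>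
     (\<forall>\<theta>\<in>\<Theta>. \<forall>x\<in>space M. f x \<theta> = exp (\<alpha> \<theta> * \<gamma> x - \<beta> \<theta> + \<delta> x)) \<and>
     (\<forall>\<theta>\<in>\<Theta>. prob_space (density M (\<lambda>x. ennreal (f x \<theta>))))"

definition segment_mean :: "('a \<Rightarrow> real) \<Rightarrow> (nat \<Rightarrow> 'a) \<Rightarrow> nat \<Rightarrow> nat \<Rightarrow> real" where
  "segment_mean \<gamma> x s u = 1 / (real u - real s) * (\<Sum>t = s + 1..u. \<gamma> (x t))"

definition loglik_change ::
  "('a \<Rightarrow> real \<Rightarrow> real) \<Rightarrow> (nat \<Rightarrow> 'a) \<Rightarrow> nat \<Rightarrow> real \<Rightarrow> real \<Rightarrow> nat \<Rightarrow> real" where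
  "loglik_change f x T \<theta>\<^sub>0 \<theta>\<^sub>1 \<tau> =
     (\<Sum>t = 1..\<tau>. ln (f (x t) \<theta>\<^sub>0)) + (\<Sum>t = \<tau> + 1..T. ln (f (x t) \<theta>\<^sub>1))"

definition loglik_no_change :: "('a \<Rightarrow> real \<Rightarrow> real) \<Rightarrow> (nat \<Rightarrow> 'a) \<Rightarrow> nat \<Rightarrow> real \<Rightarrow> real" where
  "loglik_no_change f x T \<theta>\<^sub>0 = (\<Sum>t = 1..T. ln (f (x t) \<theta>\<^sub>0))"

(* A relation rather than a function of \<tau>: a root need not exist, and its uniqueness depends on
   further properties of the family. *)
definition is_root_at ::
  "('a \<Rightarrow> real \<Rightarrow> real) \<Rightarrow> real set \<Rightarrow> (nat \<Rightarrow> 'a) \<Rightarrow> nat \<Rightarrow> real \<Rightarrow> nat \<Rightarrow> real \<Rightarrow> bool" where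
  "is_root_at f \<Theta> x T \<theta>\<^sub>0 \<tau> \<theta>\<^sub>1 \<longleftrightarrow>
     \<theta>\<^sub>1 \<in> \<Theta> - {\<theta>\<^sub>0} \<and> loglik_change f x T \<theta>\<^sub>0 \<theta>\<^sub>1 \<tau> - loglik_no_change f x T \<theta>\<^sub>0 = 0"

end

theory Submission
  imports Defs
begin

text \<open>
  A root at \<open>\<tau>\<close> is a parameter at which \<open>(\<beta> \<theta> - \<beta> \<theta>\<^sub>0) / (\<alpha> \<theta> - \<alpha> \<theta>\<^sub>0)\<close> equals the mean of \<open>\<gamma>\<close> over the
  observations after \<open>\<tau>\<close>. By strict monotonicity \<open>\<theta>\<^sub>i\<close> and \<open>\<theta>\<^sub>j\<close> are ordered like the means after
  \<open>\<tau>\<^sub>i\<close> and \<open>\<tau>\<^sub>j\<close>, and the former mean is a convex combination of the means over \<open>(\<tau>\<^sub>i, \<tau>\<^sub>j]\<close>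
  and \<open>(\<tau>\<^sub>j, T]\<close>.
\<close>

text \<open>In the root equation the terms up to \<open>\<tau>\<close> cancel, and so does
  \<open>\<delta>\<close> in every later term. What remains is affine in the sum of
  \<open>\<gamma>\<close> and can be solved for the mean.\<close>

lemma segment_mean_eq_ratio:
  assumes fam: "exponential_family M \<Theta> \<alpha> \<beta> \<gamma> \<delta> f"
    and \<theta>\<^sub>0: "\<theta>\<^sub>0 \<in> \<Theta>" and \<alpha>: "\<alpha> \<theta> \<noteq> \<alpha> \<theta>\<^sub>0"
    and x: "\<forall>t\<in>{1..T}. x t \<in> space M" and \<tau>: "\<tau> < T"
    and root: "is_root_at f \<Theta> x T \<theta>\<^sub>0 \<tau> \<theta>"
  shows "segment_mean \<gamma> x \<tau> T = (\<beta> \<theta> - \<beta> \<theta>\<^sub>0) / (\<alpha> \<theta> - \<alpha> \<theta>\<^sub>0)"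
proof -
  have ln_f: "ln (f (x t) \<eta>) = \<alpha> \<eta> * \<gamma> (x t) - \<beta> \<eta> + \<delta> (x t)"
    if "\<eta> \<in> \<Theta>" "t \<in> {\<tau> + 1..T}" for \<eta> t
    using fam x that by (auto simp: exponential_family_def)
  have \<theta>: "\<theta> \<in> \<Theta>"
    using root by (simp add: is_root_at_def)
  have split: "(\<Sum>t = 1..T. ln (f (x t) \<theta>\<^sub>0))
      = (\<Sum>t = 1..\<tau>. ln (f (x t) \<theta>\<^sub>0)) + (\<Sum>t = \<tau> + 1..T. ln (f (x t) \<theta>\<^sub>0))"
    \<comment> \<open>The side condition of the splitting rule is \<open>1 \<le> \<tau> + 1\<close>,
      so a change at \<open>\<tau> = 0\<close>, with empty first sum, is covered.\<close>
    using sum.ub_add_nat[of 1 \<tau> "\<lambda>t. ln (f (x t) \<theta>\<^sub>0)" "T - \<tau>"] \<tau> by simp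
  have "0 = (\<Sum>t = \<tau> + 1..T. ln (f (x t) \<theta>) - ln (f (x t) \<theta>\<^sub>0))"
    using root split
    by (simp add: is_root_at_def loglik_change_def loglik_no_change_def sum_subtractf)
  also have "\<dots> = (\<Sum>t = \<tau> + 1..T. (\<alpha> \<theta> - \<alpha> \<theta>\<^sub>0) * \<gamma> (x t) - (\<beta> \<theta> - \<beta> \<theta>\<^sub>0))"
    by (intro sum.cong) (simp_all add: ln_f \<theta> \<theta>\<^sub>0 algebra_simps)
  also have "\<dots> = (\<alpha> \<theta> - \<alpha> \<theta>\<^sub>0) * (\<Sum>t = \<tau> + 1..T. \<gamma> (x t))
      - (real T - real \<tau>) * (\<beta> \<theta> - \<beta> \<theta>\<^sub>0)"
    using \<tau> by (simp add: sum_subtractf sum_distrib_left of_nat_diff)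
  finally show ?thesis
    using \<alpha> \<tau> by (simp add: segment_mean_def field_simps)
qed

text \<open>The two suffixes overlap; this trades their comparison for one of adjacent disjoint
  segments, at the cost of a factor that is positive.\<close>

lemma segment_mean_diff_suffix:
  assumes "s < u" "u < T"
  shows "segment_mean \<gamma> x s T - segment_mean \<gamma> x u T
    = (real u - real s) / (real T - real s) * (segment_mean \<gamma> x s u - segment_mean \<gamma> x u T)"
proof -
  have total: "(\<Sum>t = a + 1..b. \<gamma> (x t)) = (real b - real a) * segment_mean \<gamma> x a b"
    if "a < b" for a b
    using that by (simp add: segment_mean_def)
  have "(\<Sum>t = s + 1..T. \<gamma> (x t)) = (\<Sum>t = s + 1..u. \<gamma> (x t)) + (\<Sum>t = u + 1..T. \<gamma> (x t))"
    using sum.ub_add_nat[of "s + 1" u "\<lambda>t. \<gamma> (x t)" "T - u"] assms by simp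
  then have "(real T - real s) * segment_mean \<gamma> x s T
      = (real u - real s) * segment_mean \<gamma> x s u + (real T - real u) * segment_mean \<gamma> x u T"
    using total[of s T] total[of s u] total[of u T] assms by simp
  \<comment> \<open>Subtract \<open>(real T - real s) * segment_mean \<gamma> x u T\<close> from the
    weighted identity and use T - s = (u - s) + (T - u).\<close>
  then show ?thesis
    using assms by (simp add: divide_simps) (simp add: algebra_simps)
qed

lemma sgn_diff_strict_mono_on:
  fixes g :: "real \<Rightarrow> real"
  assumes "strict_mono_on A g" "a \<in> A" "b \<in> A"
  shows "sgn (g a - g b) = sgn (a - b)"
  using strict_mono_onD[OF assms(1), of a b] strict_mono_onD[OF assms(1), of b a] assms(2,3)
  by (cases a b rule: linorder_cases) auto

theorem proposition1:
  fixes M :: "'a measure" and \<Theta> :: "real set"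
    and \<alpha> \<beta> :: "real \<Rightarrow> real" and \<gamma> \<delta> :: "'a \<Rightarrow> real"
    and f :: "'a \<Rightarrow> real \<Rightarrow> real"
    and \<theta>\<^sub>0 \<theta>\<^sub>i \<theta>\<^sub>j :: real and x :: "nat \<Rightarrow> 'a" and T \<tau>\<^sub>i \<tau>\<^sub>j :: nat
  assumes "exponential_family M \<Theta> \<alpha> \<beta> \<gamma> \<delta> f"
    and "\<theta>\<^sub>0 \<in> \<Theta>"
    and "\<forall>\<theta>\<^sub>1\<in>\<Theta> - {\<theta>\<^sub>0}. \<alpha> \<theta>\<^sub>1 \<noteq> \<alpha> \<theta>\<^sub>0"
    and "strict_mono_on (\<Theta> - {\<theta>\<^sub>0}) (\<lambda>\<theta>\<^sub>1. (\<beta> \<theta>\<^sub>1 - \<beta> \<theta>\<^sub>0) / (\<alpha> \<theta>\<^sub>1 - \<alpha> \<theta>\<^sub>0))"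
    and "\<forall>t\<in>{1..T}. x t \<in> space M"
    and "\<tau>\<^sub>i < \<tau>\<^sub>j" and "\<tau>\<^sub>j < T"
    and "is_root_at f \<Theta> x T \<theta>\<^sub>0 \<tau>\<^sub>i \<theta>\<^sub>i"
    and "is_root_at f \<Theta> x T \<theta>\<^sub>0 \<tau>\<^sub>j \<theta>\<^sub>j"
  shows "sgn (segment_mean \<gamma> x \<tau>\<^sub>i \<tau>\<^sub>j - segment_mean \<gamma> x \<tau>\<^sub>j T) = sgn (\<theta>\<^sub>i - \<theta>\<^sub>j)"
proof -
  let ?r = "\<lambda>\<theta>. (\<beta> \<theta> - \<beta> \<theta>\<^sub>0) / (\<alpha> \<theta> - \<alpha> \<theta>\<^sub>0)"
  have roots: "\<theta>\<^sub>i \<in> \<Theta> - {\<theta>\<^sub>0}" "\<theta>\<^sub>j \<in> \<Theta> - {\<theta>\<^sub>0}"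
    using assms(8,9) by (simp_all add: is_root_at_def)
  have "segment_mean \<gamma> x \<tau>\<^sub>i T = ?r \<theta>\<^sub>i" "segment_mean \<gamma> x \<tau>\<^sub>j T = ?r \<theta>\<^sub>j"
    using segment_mean_eq_ratio[OF assms(1,2) _ assms(5)] assms(3,6-9) roots by simp_all
  then have "sgn (\<theta>\<^sub>i - \<theta>\<^sub>j) = sgn (segment_mean \<gamma> x \<tau>\<^sub>i T - segment_mean \<gamma> x \<tau>\<^sub>j T)"
    using sgn_diff_strict_mono_on[OF assms(4) roots] by simp
  \<comment> \<open>The factor from \<open>segment_mean_diff_suffix\<close> has sign 1 because
    \<open>\<tau>\<^sub>i < \<tau>\<^sub>j < T\<close>.\<close>
  also have "\<dots> = sgn (segment_mean \<gamma> x \<tau>\<^sub>i \<tau>\<^sub>j - segment_mean \<gamma> x \<tau>\<^sub>j T)"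
    using assms(6,7) by (simp add: segment_mean_diff_suffix[OF assms(6,7)] sgn_mult)
  finally show ?thesis ..
qed

end
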